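(* Let \[ A=\begin{bmatrix}1&1&1\\1&1&1\\1&1&1\end{bmatrix},\quad B=\begin{bmatrix}5&0&4\\2&3&4\\2&6&1\end{bmatrix},\quad C=\begin{bmatrix}2&0&1\\0&1&2\\1&2&0\end{bmatrix},\quad D=\begin{bmatrix}3&0&3\\2&2&2\\1&4&1\end{bmatrix}, \] \[ T_1=\begin{bmatrix}7&0&5\\2&4&6\\3&8&1\end{bmatrix},\quad T_2=\begin{bmatrix}8&0&7\\4&5&6\\3&10&2\end{bmatrix}. \] Every magic square of order three, up to rotation and reflection, can be written uniquely as either $T_1+iA+jB+kC$ or $T_2+iA+jB+kD$, where $i,j,k$ are nonnegative integers. That is, for every magic square $M$ of order $3$ there is exactly one choice of form (the $T_1$-form or the $T_2$-form) and of nonnegative integers $i,j,k$ such that $M$ is obtained from the corresponding matrix by a rotation or reflection of the $3\times 3$ array.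
   Context: A magic square of order $n$ is an $n\times n$ matrix with pairwise distinct nonnegative integer entries such that all $n$ row sums, all $n$ column sums, and the two diagonal sums are equal to the same number $m$ (the magic number). Rotations and reflections refer to the action of the dihedral group of order $8$ (symmetries of the square) on the positions of the $3\times 3$ array. *)

theory Defs
  imports "Jordan_Normal_Form.Matrix"
begin

definition magic_square :: "nat \<Rightarrow> nat mat \<Rightarrow> bool" where
  "magic_square n M \<longleftrightarrow>
     M \<in> carrier_mat n n \<and>
     inj_on (\<lambda>p. M $$ p) ({..<n} \<times> {..<n}) \<and>
     (\<exists>m. (\<forall>i<n. (\<Sum>j<n. M $$ (i, j)) = m) \<and>
          (\<forall>j<n. (\<Sum>i<n. M $$ (i, j)) = m) \<and>
          (\<Sum>i<n. M $$ (i, i)) = m \<and>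
          (\<Sum>i<n. M $$ (i, n - 1 - i)) = m)"

definition quarter_turn :: "nat \<Rightarrow> nat \<times> nat \<Rightarrow> nat \<times> nat" where
  "quarter_turn n = (\<lambda>(i, j). (j, n - 1 - i))"

definition reflection :: "nat \<Rightarrow> nat \<times> nat \<Rightarrow> nat \<times> nat" where
  "reflection n = (\<lambda>(i, j). (i, n - 1 - j))"

text \<open>The dihedral group of order 8 acting on the positions of an \<open>n \<times> n\<close> array (indices
  from \<open>0\<close> to \<open>n - 1\<close>): every element is a power of the quarter turn, possibly
  preceded by the left-right reflection. Only the values at positions inside the array are
  meaningful.\<close>

definition square_symmetries :: "nat \<Rightarrow> (nat \<times> nat \<Rightarrow> nat \<times> nat) set" where
  "square_symmetries n = {(quarter_turn n ^^ a) \<circ> (reflection n ^^ b) | a b. a < 4 \<and> b < 2}"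

definition permute_positions :: "(nat \<times> nat \<Rightarrow> nat \<times> nat) \<Rightarrow> 'a mat \<Rightarrow> 'a mat" where
  "permute_positions g M = mat (dim_row M) (dim_col M) (\<lambda>p. M $$ g p)"

definition mat_A :: "nat mat" where
  "mat_A = mat_of_rows_list 3 [[1, 1, 1], [1, 1, 1], [1, 1, 1]]"

definition mat_B :: "nat mat" where
  "mat_B = mat_of_rows_list 3 [[5, 0, 4], [2, 3, 4], [2, 6, 1]]"

definition mat_C :: "nat mat" where
  "mat_C = mat_of_rows_list 3 [[2, 0, 1], [0, 1, 2], [1, 2, 0]]"

definition mat_D :: "nat mat" where
  "mat_D = mat_of_rows_list 3 [[3, 0, 3], [2, 2, 2], [1, 4, 1]]"

definition mat_T1 :: "nat mat" where
  "mat_T1 = mat_of_rows_list 3 [[7, 0, 5], [2, 4, 6], [3, 8, 1]]"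

definition mat_T2 :: "nat mat" where
  "mat_T2 = mat_of_rows_list 3 [[8, 0, 7], [4, 5, 6], [3, 10, 2]]"

datatype square_form = T1_form | T2_form

fun form_matrix :: "square_form \<Rightarrow> nat \<Rightarrow> nat \<Rightarrow> nat \<Rightarrow> nat mat" where
  "form_matrix T1_form i j k = mat_T1 + i \<cdot>\<^sub>m mat_A + j \<cdot>\<^sub>m mat_B + k \<cdot>\<^sub>m mat_C"
| "form_matrix T2_form i j k = mat_T2 + i \<cdot>\<^sub>m mat_A + j \<cdot>\<^sub>m mat_B + k \<cdot>\<^sub>m mat_D"

end

(* With centre e and a, b the offsets of two adjacent corners, every 3 x 3 array with equal line
   sums is
     e + a   e - a - b   e + b
     e - a + b   e   e + a - b
     e - b   e + a + b   e - a
   and distinctness of the entries forces a, b, a - b and a - 2 b to be nonzero.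
   The symmetries bring the largest corner to the top left and the larger of its neighbours to the
   top right, so that 0 < b < a; these a, b and the least entry i = e - a - b are then invariants of
   the array.  If a > 2 b, then (a, b) = (3, 1) + j (2, 1) + k (1, 0) for unique j, k, and if
   a < 2 b, then (a, b) = (3, 2) + j (2, 1) + k (1, 1) for unique j, k. *)
theory Submission
  imports Defs
begin

definition mat3 :: "'a \<Rightarrow> 'a \<Rightarrow> 'a \<Rightarrow> 'a \<Rightarrow> 'a \<Rightarrow> 'a \<Rightarrow> 'a \<Rightarrow> 'a \<Rightarrow> 'a \<Rightarrow> 'a mat" where
  "mat3 a b c d e f g h i = mat_of_rows_list 3 [[a, b, c], [d, e, f], [g, h, i]]"

lemma less_3_iff: "i < 3 \<longleftrightarrow> i = 0 \<or> i = 1 \<or> i = (2 :: nat)"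
  by auto

lemma dim_mat3 [simp]: "dim_row (mat3 a b c d e f g h i) = 3" "dim_col (mat3 a b c d e f g h i) = 3"
  by (simp_all add: mat3_def mat_of_rows_list_def)

lemma mat3_carrier: "mat3 a b c d e f g h i \<in> carrier_mat 3 3"
  by (rule carrier_matI) simp_all

lemma index_mat3 [simp]:
  "mat3 a b c d e f g h i $$ (0, 0) = a"
  "mat3 a b c d e f g h i $$ (0, Suc 0) = b"
  "mat3 a b c d e f g h i $$ (0, 2) = c"
  "mat3 a b c d e f g h i $$ (Suc 0, 0) = d"
  "mat3 a b c d e f g h i $$ (Suc 0, Suc 0) = e"
  "mat3 a b c d e f g h i $$ (Suc 0, 2) = f"
  "mat3 a b c d e f g h i $$ (2, 0) = g"
  "mat3 a b c d e f g h i $$ (2, Suc 0) = h"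
  "mat3 a b c d e f g h i $$ (2, 2) = i"
  by (simp_all add: mat3_def mat_of_rows_list_def)

lemma eq_mat3_iff:
  "M = mat3 a b c d e f g h i \<longleftrightarrow> M \<in> carrier_mat 3 3 \<and>
     M $$ (0, 0) = a \<and> M $$ (0, 1) = b \<and> M $$ (0, 2) = c \<and>
     M $$ (1, 0) = d \<and> M $$ (1, 1) = e \<and> M $$ (1, 2) = f \<and>
     M $$ (2, 0) = g \<and> M $$ (2, 1) = h \<and> M $$ (2, 2) = i"
  by (auto simp: mat_eq_iff less_3_iff)

lemma square_symmetries_3:
  "square_symmetries 3 =
     (\<lambda>(a, b). (quarter_turn 3 ^^ a) \<circ> (reflection 3 ^^ b)) ` ({0, 1, 2, 3} \<times> {0, 1})"
proof -
  have "{0, 1, 2, 3} = {..<4 :: nat}" "{0, 1} = {..<2 :: nat}"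
    by auto
  then show ?thesis
    by (auto simp: square_symmetries_def)
qed

text \<open>Turns membership in an orbit into a disjunction over eight explicit arrays: first the
  four rotations, then the four that involve the reflection.\<close>

lemma permute_positions_mat3:
  "(\<exists>s \<in> square_symmetries 3. M = permute_positions s (mat3 a b c d e f g h i)) \<longleftrightarrow>
     M = mat3 a b c d e f g h i \<or> M = mat3 c f i b e h a d g \<or>
     M = mat3 i h g f e d c b a \<or> M = mat3 g d a h e b i f c \<or>
     M = mat3 c b a f e d i h g \<or> M = mat3 i f c h e b g d a \<or>
     M = mat3 g h i d e f a b c \<or> M = mat3 a d g b e h c f i"
proof -
  let ?X = "mat3 a b c d e f g h i"
  let ?s = "\<lambda>m n. (quarter_turn 3 ^^ m) \<circ> (reflection 3 ^^ n)"
  have "permute_positions (?s 0 0) ?X = mat3 a b c d e f g h i"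
    "permute_positions (?s 1 0) ?X = mat3 c f i b e h a d g"
    "permute_positions (?s 2 0) ?X = mat3 i h g f e d c b a"
    "permute_positions (?s 3 0) ?X = mat3 g d a h e b i f c"
    "permute_positions (?s 0 1) ?X = mat3 c b a f e d i h g"
    "permute_positions (?s 1 1) ?X = mat3 i f c h e b g d a"
    "permute_positions (?s 2 1) ?X = mat3 g h i d e f a b c"
    "permute_positions (?s 3 1) ?X = mat3 a d g b e h c f i"
    \<comment> \<open>Numerals become \<open>Suc\<close> terms so that the powers unroll; the index
      rules are restated with \<open>Suc (Suc 0)\<close> to match.\<close>
    by (simp_all add: eq_mat3_iff permute_positions_def quarter_turn_def reflection_def
        eval_nat_numeral index_mat3[unfolded numeral_2_eq_2])
  then show ?thesis
    by (simp add: square_symmetries_3) blast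
qed

text \<open>Parametrised by the least entry \<open>i\<close> rather than by the centre, so that no
  truncated subtraction occurs.\<close>

definition std_square :: "nat \<Rightarrow> nat \<Rightarrow> nat \<Rightarrow> nat mat" where
  "std_square a b i = mat3 (i + 2 * a + b) i (i + a + 2 * b)
     (i + 2 * b) (i + a + b) (i + 2 * a) (i + a) (i + 2 * a + 2 * b) (i + b)"

text \<open>\<open>std_square\<close> is linear in \<open>(a, b, i)\<close>, and the six given
  matrices are its values: T1 at (3, 1, 0), T2 at (3, 2, 0), A at (0, 0, 1), B at (2, 1, 0), C at
  (1, 0, 0) and D at (1, 1, 0).\<close>

lemma form_matrix_eq_std_square:
  "form_matrix T1_form i j k = std_square (3 + 2 * j + k) (1 + j) i"
  "form_matrix T2_form i j k = std_square (3 + 2 * j + k) (2 + j + k) i"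
  unfolding std_square_def eq_mat3_iff
  by (simp_all add: mat_T1_def mat_T2_def mat_A_def mat_B_def mat_C_def mat_D_def
      mat3_def[symmetric] mat3_carrier)

definition symmetric_to :: "nat mat \<Rightarrow> nat mat \<Rightarrow> bool" where
  "symmetric_to M N \<longleftrightarrow> (\<exists>g \<in> square_symmetries 3. M = permute_positions g N)"

text \<open>Every symmetry fixes the centre and permutes the corners and the edge midpoints among
  themselves, so these three values depend only on the orbit. They determine \<open>a\<close>,
  \<open>b\<close> and \<open>i\<close> linearly.\<close>

lemma std_square_invariants:
  assumes "symmetric_to M (std_square a b i)" and "b < a"
  shows "M $$ (1, 1) = i + a + b"
    and "Max {M $$ (0, 0), M $$ (0, 2), M $$ (2, 0), M $$ (2, 2)} = i + 2 * a + b"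
    and "Max {M $$ (0, 1), M $$ (1, 0), M $$ (1, 2), M $$ (2, 1)} = i + 2 * a + 2 * b"
  using assms by (auto simp: symmetric_to_def std_square_def permute_positions_mat3)

lemma std_square_unique:
  assumes "symmetric_to M (std_square a b i)" "b < a"
    and "symmetric_to M (std_square a' b' i')" "b' < a'"
  shows "a = a' \<and> b = b' \<and> i = i'"
  using std_square_invariants[OF assms(1,2)] std_square_invariants[OF assms(3,4)] by linarith

lemma magic_square_mat3_iff:
  "magic_square 3 (mat3 a b c d e f g h i) \<longleftrightarrow>
     distinct [a, b, c, d, e, f, g, h, i] \<and>
     a + i = 2 * e \<and> c + g = 2 * e \<and> b + h = 2 * e \<and> d + f = 2 * e \<and>
     a + b + c = 3 * e \<and> a + d + g = 3 * e"
proof -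
  let ?M = "mat3 a b c d e f g h i"
  let ?ps = "[(0, 0), (0, 1), (0, 2), (1, 0), (1, 1), (1, 2), (2, 0), (2, 1), (2 :: nat, 2 :: nat)]"
  have "{..<3} = {0, 1, 2 :: nat}"
    by auto
  then have "{..<3} \<times> {..<3} = set ?ps"
    by auto
  moreover have "distinct ?ps"
    by simp
  ultimately have inj: "inj_on (\<lambda>p. ?M $$ p) ({..<3} \<times> {..<3}) \<longleftrightarrow> distinct (map (\<lambda>p. ?M $$ p) ?ps)"
    by (simp only: distinct_map[of _ ?ps] simp_thms)
  have sum3: "(\<Sum>j<3. u j) = u 0 + u 1 + u 2" for u :: "nat \<Rightarrow> nat"
    by (simp add: numeral_3_eq_3 numeral_2_eq_2)
  have all3: "(\<forall>j<3. P j) \<longleftrightarrow> P 0 \<and> P 1 \<and> P 2" for P :: "nat \<Rightarrow> bool"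
    by (auto simp: less_3_iff)
  have lines: "(\<exists>m. (a + b + c = m \<and> d + e + f = m \<and> g + h + i = m) \<and>
        (a + d + g = m \<and> b + e + h = m \<and> c + f + i = m) \<and> a + e + i = m \<and> c + e + g = m) \<longleftrightarrow>
      a + i = 2 * e \<and> c + g = 2 * e \<and> b + h = 2 * e \<and> d + f = 2 * e \<and>
      a + b + c = 3 * e \<and> a + d + g = 3 * e" (is "?L \<longleftrightarrow> ?R")
  proof
    assume ?L
    then obtain m where m: "a + b + c = m" "g + h + i = m" "a + d + g = m"
      "d + e + f = m" "b + e + h = m" "a + e + i = m" "c + e + g = m"
      by blast
    \<comment> \<open>The middle column and both diagonals cover the top and bottom rows once and
      the centre three times, so \<open>3 * m = 2 * m + 3 * e\<close>.\<close>
    have "(b + e + h) + (a + e + i) + (c + e + g) = (a + b + c) + (g + h + i) + 3 * e"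
      by simp
    then have m3: "m = 3 * e"
      unfolding m by simp
    have "d + f = 2 * e" "b + h = 2 * e" "a + i = 2 * e" "c + g = 2 * e"
      using m(4-7) unfolding m3 by simp_all
    then show ?R
      using m(1,3) unfolding m3 by blast
  next
    assume ?R
    then have R: "a + i = 2 * e" "c + g = 2 * e" "b + h = 2 * e" "d + f = 2 * e"
      "a + b + c = 3 * e" "a + d + g = 3 * e"
      by blast+
    \<comment> \<open>The outer rows together consist of three opposite pairs, each of sum
      \<open>2 * e\<close>; the outer columns are treated alike.\<close>
    have "(a + b + c) + (g + h + i) = (a + i) + (c + g) + (b + h)"
      by simp
    then have "g + h + i = 3 * e"
      unfolding R by simp
    moreover have "(a + d + g) + (c + f + i) = (a + i) + (c + g) + (d + f)"
      by simp
    then have "c + f + i = 3 * e"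
      unfolding R by simp
    moreover have "d + e + f = 3 * e" "b + e + h = 3 * e" "a + e + i = 3 * e" "c + e + g = 3 * e"
      using R(1-4) by simp_all
    ultimately show ?L
      using R(5,6) by blast
  qed
  have "magic_square 3 ?M \<longleftrightarrow> distinct [a, b, c, d, e, f, g, h, i] \<and>
      (\<exists>m. (a + b + c = m \<and> d + e + f = m \<and> g + h + i = m) \<and>
        (a + d + g = m \<and> b + e + h = m \<and> c + f + i = m) \<and> a + e + i = m \<and> c + e + g = m)"
  proof -
    have "3 - 1 - 0 = (2 :: nat)" "3 - 1 - 1 = (0 + 1 :: nat)" "3 - 1 - 2 = (0 :: nat)"
      by simp_all
    then show ?thesis
      unfolding magic_square_def inj sum3 all3
      by (simp only: mat3_carrier One_nat_def add_0 index_mat3 list.map simp_thms)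
  qed
  then show ?thesis
    unfolding lines .
qed

lemma mat3_eq_std_square:
  assumes "magic_square 3 (mat3 a b c d e f g h i)" and "i < g" "g < c" "c < a"
  obtains x y where "mat3 a b c d e f g h i = std_square x y b" "0 < y" "y < x" "x \<noteq> 2 * y"
proof -
  have "d \<noteq> g" and eqs: "a + i = 2 * e" "c + g = 2 * e" "b + h = 2 * e" "d + f = 2 * e"
    "a + b + c = 3 * e" "a + d + g = 3 * e"
    using assms(1) unfolding magic_square_mat3_iff by auto
  \<comment> \<open>The centre is the mean of \<open>c\<close> and \<open>g\<close>, so it lies
    below the larger one; hence the offsets \<open>x\<close> and \<open>y\<close> are
    positive.\<close>
  have "e < c" "e < a"
    using eqs(2) assms(3,4) by linarith+
  then obtain x y where a: "a = e + x" and c: "c = e + y"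
    by (metis less_imp_add_positive)
  have e: "e = b + x + y"
    using eqs(5) a c by linarith
  have f: "g + y = e" "i + x = e" "h = e + x + y" "d + x = e + y" "f + y = e + x"
    using eqs a c by linarith+
  show thesis
  proof (rule that)
    show "mat3 a b c d e f g h i = std_square x y b"
      using a c e f unfolding std_square_def by (simp add: mult_2 add_ac)
    show "0 < y" "y < x"
      using \<open>e < c\<close> assms(4) a c by simp_all
    \<comment> \<open>Here \<open>d = e - x + y\<close> and \<open>g = e - y\<close>, which would
      coincide if \<open>x = 2 * y\<close>.\<close>
    show "x \<noteq> 2 * y"
      using \<open>d \<noteq> g\<close> f(1,4) by linarith
  qed
qed

text \<open>Opposite corners have equal sums, so the largest and the least corner are opposite. This
  leaves eight orders of the corners, one for each symmetry.\<close>

lemma magic_square_3_symmetric_ordered: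
  assumes "magic_square 3 M"
  obtains a b c d e f g h i where "symmetric_to M (mat3 a b c d e f g h i)"
    and "magic_square 3 (mat3 a b c d e f g h i)" "i < g" "g < c" "c < a"
proof -
  have "M = mat3 (M $$ (0, 0)) (M $$ (0, 1)) (M $$ (0, 2)) (M $$ (1, 0)) (M $$ (1, 1)) (M $$ (1, 2))
      (M $$ (2, 0)) (M $$ (2, 1)) (M $$ (2, 2))"
    using assms by (simp only: eq_mat3_iff magic_square_def simp_thms)
  then obtain a b c d e f g h i where M: "M = mat3 a b c d e f g h i"
    by (rule that)
  have dist: "distinct [a, b, c, d, e, f, g, h, i]"
    and eqs: "a + i = 2 * e" "c + g = 2 * e" "b + h = 2 * e" "d + f = 2 * e"
      "a + b + c = 3 * e" "a + d + g = 3 * e"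
    using assms unfolding M magic_square_mat3_iff by blast+
  have "(i < g \<and> g < c \<and> c < a) \<or> (g < a \<and> a < i \<and> i < c) \<or>
        (a < c \<and> c < g \<and> g < i) \<or> (c < i \<and> i < a \<and> a < g) \<or>
        (g < i \<and> i < a \<and> a < c) \<or> (a < g \<and> g < c \<and> c < i) \<or>
        (c < a \<and> a < i \<and> i < g) \<or> (i < c \<and> c < g \<and> g < a)"
  proof -
    have "a \<noteq> c" "a \<noteq> g" "c \<noteq> g" "a \<noteq> i"
      using dist by simp_all
    then have "a < c \<or> c < a" "a < g \<or> g < a" "c < g \<or> g < c" "a < i \<or> i < a"
      by (simp_all only: neq_iff)
    \<comment> \<open>Since \<open>a + i = c + g\<close>, comparing two adjacent corners settles the
      comparison of their opposites.\<close>
    moreover have "c < a \<longleftrightarrow> i < g" "g < a \<longleftrightarrow> i < c" "a < c \<longleftrightarrow> g < i" "a < g \<longleftrightarrow> c < i"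
      using eqs(1,2) by linarith+
    ultimately show ?thesis
      by argo
  qed
  moreover have "symmetric_to M (mat3 a b c d e f g h i)" "symmetric_to M (mat3 c f i b e h a d g)"
    "symmetric_to M (mat3 i h g f e d c b a)" "symmetric_to M (mat3 g d a h e b i f c)"
    "symmetric_to M (mat3 c b a f e d i h g)" "symmetric_to M (mat3 i f c h e b g d a)"
    "symmetric_to M (mat3 g h i d e f a b c)" "symmetric_to M (mat3 a d g b e h c f i)"
    by (simp_all add: symmetric_to_def permute_positions_mat3 M)
  moreover have "magic_square 3 (mat3 a b c d e f g h i)" "magic_square 3 (mat3 c f i b e h a d g)"
    "magic_square 3 (mat3 i h g f e d c b a)" "magic_square 3 (mat3 g d a h e b i f c)"
    "magic_square 3 (mat3 c b a f e d i h g)" "magic_square 3 (mat3 i f c h e b g d a)"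
    "magic_square 3 (mat3 g h i d e f a b c)" "magic_square 3 (mat3 a d g b e h c f i)"
    unfolding magic_square_mat3_iff
    by (intro conjI; (use dist in force | use eqs in linarith))+
  ultimately show thesis
    by (elim disjE conjE) (rule that; assumption)+
qed

lemma magic_square_3_std_square:
  assumes "magic_square 3 M"
  obtains a b i where "symmetric_to M (std_square a b i)" "0 < b" "b < a" "a \<noteq> 2 * b"
  using magic_square_3_symmetric_ordered[OF assms] mat3_eq_std_square by metis

text \<open>The sign of \<open>a - 2 * b\<close> reveals the form: over the integers it is
  \<open>1 + k\<close> for T1 and \<open>- 1 - k\<close> for T2. This also gives \<open>k\<close>,
  and then \<open>a\<close> gives \<open>j\<close>.\<close>

lemma form_matrix_unique:
  assumes "symmetric_to M (form_matrix F i j k)" "symmetric_to M (form_matrix F' i' j' k')"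
  shows "F = F' \<and> i = i' \<and> j = j' \<and> k = k'"
proof -
  have form: "\<exists>a b. form_matrix F i j k = std_square a b i \<and> b < a \<and>
      a = 3 + 2 * j + k \<and> b = (if F = T1_form then 1 + j else 2 + j + k)" for F i j k
    using form_matrix_eq_std_square by (cases F) auto
  obtain a b where *: "form_matrix F i j k = std_square a b i" "b < a"
    "a = 3 + 2 * j + k" "b = (if F = T1_form then 1 + j else 2 + j + k)"
    using form by blast
  obtain a' b' where **: "form_matrix F' i' j' k' = std_square a' b' i'" "b' < a'"
    "a' = 3 + 2 * j' + k'" "b' = (if F' = T1_form then 1 + j' else 2 + j' + k')"
    using form by blast
  have "a = a'" "b = b'" "i = i'"
    using std_square_unique[of M a b i a' b' i'] assms * ** by auto
  then show ?thesis
    using *(3,4) **(3,4) by (cases F; cases F') simp_all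
qed

theorem theorem2p1:
  fixes M :: "nat mat"
  assumes "magic_square 3 M"
  shows "\<exists>!(form, i, j, k). \<exists>g \<in> square_symmetries 3.
           M = permute_positions g (form_matrix form i j k)"
proof -
  obtain a b i where std: "symmetric_to M (std_square a b i)" and "0 < b" "b < a" "a \<noteq> 2 * b"
    using magic_square_3_std_square[OF assms] .
  have "\<exists>F j k. symmetric_to M (form_matrix F i j k)"
  proof (cases "2 * b < a")
    case True
    \<comment> \<open>Solving the T1 parametrisation for \<open>j\<close> and \<open>k\<close>;
      \<open>0 < b\<close> and \<open>2 * b < a\<close> make the subtractions exact.\<close>
    then have "a = 3 + 2 * (b - 1) + (a - 2 * b - 1)" "b = 1 + (b - 1)"
      using \<open>0 < b\<close> by linarith+
    then show ?thesis
      using std form_matrix_eq_std_square(1) by metis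
  next
    case False
    \<comment> \<open>Likewise for T2, where \<open>b < a\<close> and \<open>a < 2 * b\<close> make
      the subtractions exact.\<close>
    then have "a = 3 + 2 * (a - b - 1) + (2 * b - a - 1)" "b = 2 + (a - b - 1) + (2 * b - a - 1)"
      using \<open>b < a\<close> \<open>a \<noteq> 2 * b\<close> by linarith+
    then show ?thesis
      using std form_matrix_eq_std_square(2) by metis
  qed
  then obtain F j k where "symmetric_to M (form_matrix F i j k)"
    by blast
  then have "\<exists>!(form, i, j, k). symmetric_to M (form_matrix form i j k)"
    by (intro ex1I[of _ "(F, i, j, k)"]) (auto dest: form_matrix_unique)
  then show ?thesis
    unfolding symmetric_to_def .
qed

end
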